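(* Let $\mathbb{F}$ be a field, let $V$ be a linear subspace of $\mathbb{F}^{n}$, let $d=\dim(V)$, and suppose $\dim(\langle V\cup (V\cdot V)\rangle)=d+h$. Then $[n]$ can be partitioned into $d+1$ sets $A_1,\dots,A_{d},B$ such that $A_{i}$ is a maximal set of twins for $V$ for each $i\in [d]$, and $\dim(V|_{B})\leq 2h$.
   Context: $\langle\cdot\rangle$ denotes linear span over $\mathbb{F}$. For $v,w\in\mathbb{F}^n$, $v\cdot w$ is the coordinatewise product $(v\cdot w)(i)=v(i)w(i)$, and $V\cdot V=\{v\cdot w: v,w\in V\}$. For $B\subset[n]$, $V|_B=\{v|_B: v\in V\}\subset\mathbb{F}^B$, where $v|_B$ is the restriction of $v$ to the coordinates in $B$. Two indices $i,j\in[n]$ are twins for $V$ if $v(i)=v(j)$ for every $v\in V$ and $v(i)\neq 0$ for at least one $v\in V$. This (together with $i\sim i$ whenever $v(i)\ne 0$ for some $v\in V$) is an equivalence relation on the set of indices $i$ with $v(i)\neq0$ for some $v\in V$; a maximal set of twins for $V$ is a full equivalence class of this relation. *)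

theory Defs
  imports "HOL-Analysis.Analysis"
begin

text \<open>
  The space F^n is \<open>'a ^ 'n\<close> for a field \<open>'a\<close>, with \<open>UNIV :: 'n set\<close> in the role of [n]. Multiplication
  \<open>v * w\<close> on this type is the coordinatewise product.
\<close>

definition coord_prods :: "('a::field ^ 'n) set \<Rightarrow> ('a ^ 'n) set" where
  "coord_prods V = {v * w | v w. v \<in> V \<and> w \<in> V}"

text \<open>
  The space F^B is identified with the subspace of vectors vanishing outside \<open>B\<close>, so the
  restriction of a vector to \<open>B\<close> is extended by zero.
\<close>

definition restrict_vec :: "'n set \<Rightarrow> 'a::field ^ 'n \<Rightarrow> 'a ^ 'n" where
  "restrict_vec B v = (\<chi> i. if i \<in> B then v $ i else 0)"

definition active :: "('a::field ^ 'n) set \<Rightarrow> 'n set" where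
  "active V = {i. \<exists>v\<in>V. v $ i \<noteq> 0}"

text \<open>For \<open>i = j\<close> this says that \<open>i \<in> active V\<close>, so the relation is reflexive exactly there.\<close>

definition twins :: "('a::field ^ 'n) set \<Rightarrow> 'n \<Rightarrow> 'n \<Rightarrow> bool" where
  "twins V i j \<longleftrightarrow> (\<forall>v\<in>V. v $ i = v $ j) \<and> (\<exists>v\<in>V. v $ i \<noteq> 0)"

definition maximal_twin_set :: "('a::field ^ 'n) set \<Rightarrow> 'n set \<Rightarrow> bool" where
  "maximal_twin_set V A \<longleftrightarrow> A \<in> active V // {(i, j). twins V i j}"

lemma equiv_twins: "equiv (active V) {(i, j). twins V i j}"
  by (rule equivI) (auto simp: active_def twins_def refl_on_def sym_def trans_def)

end

theory Submission
  imports Defs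
begin

text \<open>
  Choose a set \<open>I\<close> of \<open>d\<close> coordinates with a dual basis \<open>b\<close> of \<open>V\<close>; the sets \<open>A\<^sub>i\<close> are the twin
  classes of the members of \<open>I\<close>. The vectors \<open>b\<^sub>i v - v(i) b\<^sub>i\<close> lie in the span of \<open>V \<union> V \<cdot> V\<close> and
  vanish on \<open>I\<close>, so they span a space meeting \<open>V\<close> trivially, of dimension at most \<open>h\<close>.
  On a set \<open>Z\<close> of coordinates where \<open>b\<^sub>i\<close> has no zero, the vectors \<open>b\<^sub>i v\<close> have the same rank as \<open>V\<close>.
  Hence the vectors \<open>b\<^sub>i v - v(i) b\<^sub>i\<close> have rank at least \<open>dim (V|\<^sub>Z) - 1\<close> on \<open>Z\<close>, and also rank
  at least 1 if \<open>Z\<close> is nonempty and contains no twin of \<open>i\<close>, so rank at least \<open>dim (V|\<^sub>Z) / 2\<close>.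
  Adding the \<open>i \<in> I\<close> one at a time, with \<open>Z\<close> the part of the support of \<open>b\<^sub>i\<close> not yet
  covered, these ranks add up.
\<close>

section \<open>Dimensions of unions and of linear images\<close>

lemma linear_restrict_vec:
  "Vector_Spaces.linear (*s) (*s) (restrict_vec Z :: 'a::field ^ 'n \<Rightarrow> 'a ^ 'n)"
  by (simp add: Vector_Spaces.linear_iff vec.vector_space_axioms restrict_vec_def vec_eq_iff)

lemma linear_times_left:
  "Vector_Spaces.linear (*s) (*s) ((*) b :: 'a::field ^ 'n \<Rightarrow> 'a ^ 'n)"
  by (simp add: Vector_Spaces.linear_iff vec.vector_space_axioms vec_eq_iff algebra_simps)

lemma dim_Un_le:
  fixes S T :: "('a::field ^ 'n) set"
  shows "vec.dim (S \<union> T) \<le> vec.dim S + vec.dim T"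
proof -
  have "vec.dim (S \<union> T) = vec.dim {x + y | x y. x \<in> vec.span S \<and> y \<in> vec.span T}"
    using vec.span_Un[of S T] by (metis vec.dim_span)
  also have "\<dots> \<le> vec.dim S + vec.dim T"
    using vec.dim_sums_Int[of "vec.span S" "vec.span T"] by simp
  finally show ?thesis .
qed

lemma dim_Un_ge_of_Int_trivial:
  fixes S T :: "('a::field ^ 'n) set"
  assumes "vec.subspace S" "vec.subspace T" "S \<inter> T \<subseteq> {0}"
  shows "vec.dim S + vec.dim T \<le> vec.dim (S \<union> T)"
proof -
  have "vec.dim (S \<union> T) = vec.dim {x + y | x y. x \<in> S \<and> y \<in> T}"
    using vec.span_Un[of S T] vec.dim_span[of "S \<union> T"]
    by (simp add: vec.span_eq_iff[THEN iffD2, OF assms(1)] vec.span_eq_iff[THEN iffD2, OF assms(2)])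
  moreover have "vec.dim (S \<inter> T) = 0"
    using assms(3) by simp
  ultimately show ?thesis
    using vec.dim_sums_Int[OF assms(1,2)] by linarith
qed

lemma dim_Un_ge_kernel_image:
  fixes K Q :: "('a::field ^ 'n) set" and f :: "'a ^ 'n \<Rightarrow> 'a ^ 'n"
  assumes f: "Vector_Spaces.linear (*s) (*s) f"
    and K: "vec.subspace K" and f0: "\<And>x. x \<in> K \<Longrightarrow> f x = 0"
  shows "vec.dim K + vec.dim (f ` Q) \<le> vec.dim (K \<union> Q)"
proof -
  obtain C where C: "C \<subseteq> f ` Q" "vec.independent C" "f ` Q \<subseteq> vec.span C"
    by (meson vec.maximal_independent_subset)
  obtain D where D: "D \<subseteq> Q" "inj_on f D" "C = f ` D"
    using C(1) by (auto simp: subset_image_inj)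
  have inj: "inj_on f (vec.span D)"
    using vec.linear_inj_on_span_independent_image[OF f] C D by blast
  have 0: "K \<inter> vec.span D \<subseteq> {0}"
  proof clarsimp
    fix x assume "x \<in> K" "x \<in> vec.span D"
    moreover have "f 0 = 0" using f0 K vec.subspace_0 by blast
    ultimately show "x = 0"
      using inj f0 vec.span_zero by (metis inj_onD)
  qed
  have "vec.dim (f ` Q) \<le> vec.dim C"
    by (rule vec.dim_mono[OF C(3)])
  also have "\<dots> = vec.dim D"
    using vec.dim_image_eq[OF f inj] D by simp
  finally have "vec.dim K + vec.dim (f ` Q) \<le> vec.dim K + vec.dim (vec.span D)"
    by simp
  also have "\<dots> \<le> vec.dim (K \<union> vec.span D)"
    by (rule dim_Un_ge_of_Int_trivial[OF K vec.subspace_span 0])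
  also have "\<dots> \<le> vec.dim (K \<union> Q)"
    using vec.span_mono[of D "K \<union> Q"] D(1) vec.span_superset[of "K \<union> Q"]
    by (intro vec.dim_mono) blast
  finally show ?thesis .
qed

section \<open>Coordinates with a dual basis\<close>

lemma dual_basis_exists:
  fixes V :: "('a::field ^ 'n) set"
  assumes V: "vec.subspace V"
  obtains I b where "card I = vec.dim V" "\<And>i. i \<in> I \<Longrightarrow> b i \<in> V"
    "\<And>i j. i \<in> I \<Longrightarrow> j \<in> I \<Longrightarrow> b i $ j = (if j = i then 1 else 0)"
    "\<And>v. v \<in> V \<Longrightarrow> v = (\<Sum>i\<in>I. v $ i *s b i)"
proof -
  \<comment> \<open>\<open>sep I\<close> says that a vector of \<open>V\<close> is determined by its
    entries on \<open>I\<close>. A smallest such \<open>I\<close> will serve.\<close>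
  define sep where "sep I \<longleftrightarrow> (\<forall>v\<in>V. (\<forall>i\<in>I. v $ i = 0) \<longrightarrow> v = 0)" for I
  have "sep UNIV" by (auto simp: sep_def vec_eq_iff)
  then obtain I where I: "sep I" and min: "\<And>J. sep J \<Longrightarrow> card I \<le> card J"
    by (metis ex_has_least_nat)
  have "\<exists>b\<in>V. \<forall>j\<in>I. b $ j = (if j = i then 1 else 0)" if i: "i \<in> I" for i
  proof -
    \<comment> \<open>By minimality some nonzero \<open>v\<close> in \<open>V\<close> vanishes on
      the rest of \<open>I\<close>. It cannot vanish at \<open>i\<close> too, so it can be scaled to
      the dual vector.\<close>
    have "\<not> sep (I - {i})"
      using min[of "I - {i}"] i by (metis card_Diff1_less finite not_le)
    then obtain v where v: "v \<in> V" "\<forall>j\<in>I - {i}. v $ j = 0" "v \<noteq> 0"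
      by (auto simp: sep_def)
    with I have "v $ i \<noteq> 0" unfolding sep_def by blast
    with v show ?thesis
      by (intro bexI[of _ "inverse (v $ i) *s v"]) (auto simp: vec.subspace_scale[OF V])
  qed
  then obtain b where bV: "\<And>i. i \<in> I \<Longrightarrow> b i \<in> V"
    and b: "\<And>i j. i \<in> I \<Longrightarrow> j \<in> I \<Longrightarrow> b i $ j = (if j = i then 1 else 0)"
    by metis
  have coord: "(\<Sum>i\<in>I. c i *s b i) $ j = c j" if "j \<in> I" for c j
  proof -
    have "(\<Sum>i\<in>I. c i *s b i) $ j = (\<Sum>i\<in>I. if j = i then c i else 0)"
      unfolding sum_component using that b by (intro sum.cong) auto
    then show ?thesis using that by simp
  qed
  have expand: "v = (\<Sum>i\<in>I. v $ i *s b i)" if "v \<in> V" for v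
  proof -
    \<comment> \<open>The difference lies in \<open>V\<close> and vanishes on \<open>I\<close>,
      hence is 0 by \<open>sep I\<close>.\<close>
    have "v - (\<Sum>i\<in>I. v $ i *s b i) \<in> V"
      using that V bV by (intro vec.subspace_diff vec.subspace_sum vec.subspace_scale)
    moreover have "\<forall>j\<in>I. (v - (\<Sum>i\<in>I. v $ i *s b i)) $ j = 0"
      using coord by simp
    ultimately show ?thesis using I unfolding sep_def by force
  qed
  have inj: "inj_on b I"
    using b by (intro inj_onI) (metis zero_neq_one)
  have "vec.independent (b ` I)"
  proof (rule vec.independent_if_scalars_zero)
    fix c x assume "(\<Sum>x\<in>b ` I. c x *s x) = 0" "x \<in> b ` I"
    then show "c x = 0"
      using coord[of _ "c \<circ> b"] by (auto simp: sum.reindex[OF inj])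
  qed simp
  moreover have "V \<subseteq> vec.span (b ` I)"
  proof
    fix v assume "v \<in> V"
    have "(\<Sum>i\<in>I. v $ i *s b i) \<in> vec.span (b ` I)"
      by (intro vec.span_sum vec.span_scale vec.span_base) auto
    then show "v \<in> vec.span (b ` I)"
      using expand[OF \<open>v \<in> V\<close>] by simp
  qed
  ultimately have "card I = vec.dim V"
    using vec.basis_card_eq_dim[of "b ` I" V] bV card_image[OF inj] by auto
  then show thesis using that bV b expand by blast
qed

section \<open>Rank of the vectors \<open>b * v - (v $ i) *s b\<close>\<close>

lemma dim_restrict_le_twice_defect:
  fixes V :: "('a::field ^ 'n) set"
  assumes nz: "\<And>k. k \<in> Z \<Longrightarrow> b $ k \<noteq> 0"
    and nontwin: "\<And>k. k \<in> Z \<Longrightarrow> \<exists>v\<in>V. v $ k \<noteq> v $ i"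
  shows "vec.dim (restrict_vec Z ` V)
           \<le> 2 * vec.dim (restrict_vec Z ` (\<lambda>v. b * v - (v $ i) *s b) ` V)"
    (is "_ \<le> 2 * vec.dim ?Q")
proof (cases "Z = {}")
  case True
  then have "restrict_vec Z ` V \<subseteq> {0}"
    by (auto simp: restrict_vec_def vec_eq_iff)
  then have "vec.dim (restrict_vec Z ` V) = 0" by simp
  then show ?thesis by linarith
next
  case False
  then obtain k v where k: "k \<in> Z" "v \<in> V" "v $ k \<noteq> v $ i"
    using nontwin by blast
  \<comment> \<open>The entry factors, and neither factor is 0: \<open>b\<close> has no zero on
    \<open>Z\<close>, and \<open>v\<close> separates \<open>k\<close> from \<open>i\<close>.\<close>
  have "restrict_vec Z (b * v - (v $ i) *s b) $ k = b $ k * (v $ k - v $ i)"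
    using k by (simp add: restrict_vec_def algebra_simps)
  then have "restrict_vec Z (b * v - (v $ i) *s b) \<noteq> 0"
    using k nz by (metis mult_eq_0_iff right_minus_eq zero_index)
  then have "\<not> ?Q \<subseteq> {0}" using k(2) by blast
  then have "vec.dim ?Q \<noteq> 0"
    by (subst vec.dim_eq_0)
  then have ge1: "1 \<le> vec.dim ?Q" by linarith
  \<comment> \<open>On vectors supported in \<open>Z\<close>, multiplication by \<open>b\<close> can
    be undone entry by entry.\<close>
  have "inj_on ((*) b) (vec.span (restrict_vec Z ` V))"
  proof (rule inj_onI)
    have van: "x $ j = 0" if "j \<notin> Z" "x \<in> vec.span (restrict_vec Z ` V)" for x :: "'a^'n" and j
      using that(2) by (induction rule: vec.span_induct_alt) (auto simp: restrict_vec_def that(1))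
    fix x y assume xy: "x \<in> vec.span (restrict_vec Z ` V)" "y \<in> vec.span (restrict_vec Z ` V)"
      and eq: "b * x = b * y"
    have "x $ j = y $ j" for j
    proof (cases "j \<in> Z")
      case True
      have "b $ j * x $ j = b $ j * y $ j" using eq by (metis vector_mult_component)
      then show ?thesis using nz[OF True] by simp
    qed (use van xy in simp)
    then show "x = y" by (simp add: vec_eq_iff)
  qed
  then have "vec.dim (restrict_vec Z ` V) = vec.dim ((*) b ` restrict_vec Z ` V)"
    by (rule vec.dim_image_eq[OF linear_times_left, symmetric])
  \<comment> \<open>The correction terms are all multiples of the single vector
    \<open>restrict_vec Z b\<close>, so they cost at most one dimension.\<close>
  also have "\<dots> \<le> vec.dim (?Q \<union> {restrict_vec Z b})"
  proof (rule vec.dim_mono, clarify)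
    fix v assume "v \<in> V"
    have "b * restrict_vec Z v
        = restrict_vec Z (b * v - (v $ i) *s b) + (v $ i) *s restrict_vec Z b"
      by (simp add: restrict_vec_def vec_eq_iff)
    moreover have "\<dots> \<in> vec.span (?Q \<union> {restrict_vec Z b})"
      using \<open>v \<in> V\<close> by (intro vec.span_add vec.span_scale vec.span_base) auto
    ultimately show "b * restrict_vec Z v \<in> vec.span (?Q \<union> {restrict_vec Z b})"
      by simp
  qed
  also have "\<dots> \<le> vec.dim ?Q + vec.dim {restrict_vec Z b}"
    by (rule dim_Un_le)
  also have "\<dots> \<le> vec.dim ?Q + 1" by simp
  \<comment> \<open>With \<open>r = vec.dim ?Q\<close>, the bound \<open>r + 1\<close> is at most
    \<open>2 * r\<close> because \<open>r\<close> is at least 1.\<close>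
  finally show ?thesis using ge1 by simp
qed

lemma dim_restrict_Un_le:
  fixes V :: "('a::field ^ 'n) set"
  assumes "C \<inter> Z = {}"
  shows "vec.dim (restrict_vec (C \<union> Z) ` V)
           \<le> vec.dim (restrict_vec C ` V) + vec.dim (restrict_vec Z ` V)"
proof -
  have "vec.dim (restrict_vec (C \<union> Z) ` V)
      \<le> vec.dim (restrict_vec C ` V \<union> restrict_vec Z ` V)"
  proof (rule vec.dim_mono, clarify)
    fix v assume "v \<in> V"
    have "restrict_vec (C \<union> Z) v = restrict_vec C v + restrict_vec Z v"
      using assms by (auto simp: restrict_vec_def vec_eq_iff)
    moreover have "\<dots> \<in> vec.span (restrict_vec C ` V \<union> restrict_vec Z ` V)"
      using \<open>v \<in> V\<close> by (intro vec.span_add vec.span_base) auto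
    ultimately show "restrict_vec (C \<union> Z) v
        \<in> vec.span (restrict_vec C ` V \<union> restrict_vec Z ` V)" by simp
  qed
  also have "\<dots> \<le> vec.dim (restrict_vec C ` V) + vec.dim (restrict_vec Z ` V)"
    by (rule dim_Un_le)
  finally show ?thesis .
qed

text \<open>Induction on \<open>J\<close>. The part \<open>Z\<close> of the support of the new
  \<open>b i\<close> that is not yet covered is invisible to the earlier vectors, so the rank gained
  on \<open>Z\<close> comes on top of theirs.\<close>

lemma dim_restrict_supports_le:
  fixes V :: "('a::field ^ 'n) set" and b :: "'n \<Rightarrow> 'a ^ 'n"
  assumes "finite J"
    and nontwin: "\<And>i k. i \<in> J \<Longrightarrow> k \<in> B \<Longrightarrow> \<exists>v\<in>V. v $ k \<noteq> v $ i"
  shows "vec.dim (restrict_vec {k\<in>B. \<exists>i\<in>J. b i $ k \<noteq> 0} ` V)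
           \<le> 2 * vec.dim (\<Union>i\<in>J. (\<lambda>v. b i * v - (v $ i) *s b i) ` V)"
  using assms
proof (induction J rule: finite_induct)
  case empty
  have "restrict_vec {} ` V \<subseteq> {0}" by (auto simp: restrict_vec_def vec_eq_iff)
  then have "vec.dim (restrict_vec {} ` V) = 0" by simp
  then show ?case by simp
next
  case (insert i J)
  let ?q = "\<lambda>i. (\<lambda>v. b i * v - (v $ i) *s b i) ` V"
  define C where "C = {k\<in>B. \<exists>i\<in>J. b i $ k \<noteq> 0}"
  define Z where "Z = {k\<in>B. b i $ k \<noteq> 0} - C"
  define K where "K = vec.span (\<Union>i\<in>J. ?q i)"
  have IH: "vec.dim (restrict_vec C ` V) \<le> 2 * vec.dim K"
    using insert.IH insert.prems by (simp add: C_def K_def)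
  have Z: "vec.dim (restrict_vec Z ` V) \<le> 2 * vec.dim (restrict_vec Z ` ?q i)"
    by (rule dim_restrict_le_twice_defect) (use insert.prems in \<open>auto simp: Z_def\<close>)
  \<comment> \<open>The entry at \<open>k\<close> of a generator for \<open>j\<close> in
    \<open>J\<close> is \<open>b j $ k * (v $ k - v $ j)\<close>, and \<open>b j $ k = 0\<close> for
    \<open>k\<close> in \<open>Z\<close>, since \<open>Z\<close> avoids \<open>C\<close>.\<close>
  have van: "restrict_vec Z x = 0" if "x \<in> K" for x
    using that unfolding K_def
  proof (induction rule: vec.span_induct_alt)
    case base
    show ?case by (simp add: restrict_vec_def vec_eq_iff)
  next
    case (step c x y)
    then have "x $ k = 0" if "k \<in> Z" for k
      using that by (auto simp: Z_def C_def)
    moreover have "y $ k = 0" if "k \<in> Z" for k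
      using step(2) that by (simp add: restrict_vec_def vec_eq_iff split: if_splits)
    ultimately show ?case by (simp add: restrict_vec_def vec_eq_iff)
  qed
  have "{k\<in>B. \<exists>i\<in>insert i J. b i $ k \<noteq> 0} = C \<union> Z"
    by (auto simp: C_def Z_def)
  then have "vec.dim (restrict_vec {k\<in>B. \<exists>i\<in>insert i J. b i $ k \<noteq> 0} ` V)
      \<le> vec.dim (restrict_vec C ` V) + vec.dim (restrict_vec Z ` V)"
    using dim_restrict_Un_le[of C Z V] by (simp add: Z_def)
  also have "\<dots> \<le> 2 * (vec.dim K + vec.dim (restrict_vec Z ` ?q i))"
    using IH Z by simp
  also have "vec.dim K + vec.dim (restrict_vec Z ` ?q i) \<le> vec.dim (K \<union> ?q i)"
    by (rule dim_Un_ge_kernel_image[OF linear_restrict_vec _ van])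
      (simp_all add: K_def vec.subspace_span)
  also have "vec.dim (K \<union> ?q i) \<le> vec.dim (\<Union>i\<in>insert i J. ?q i)"
  proof (rule vec.dim_mono)
    have "K \<subseteq> vec.span (\<Union>i\<in>insert i J. ?q i)"
      unfolding K_def by (rule vec.span_mono) auto
    then show "K \<union> ?q i \<subseteq> vec.span (\<Union>i\<in>insert i J. ?q i)"
      by (auto intro: vec.span_base)
  qed
  finally show ?case by simp
qed

section \<open>Twin classes of the dual coordinates and the dimension count\<close>

theorem theorem2p1:
  fixes V :: "('a::field ^ 'n) set" and d h :: nat
  assumes "vec.subspace V"
    and "vec.dim V = d"
    and "vec.dim (vec.span (V \<union> coord_prods V)) = d + h"
  shows "\<exists>(A :: nat \<Rightarrow> 'n set) (B :: 'n set).
           (\<Union>i\<in>{1..d}. A i) \<union> B = UNIV \<and>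
           disjoint_family_on A {1..d} \<and>
           (\<forall>i\<in>{1..d}. A i \<inter> B = {}) \<and>
           (\<forall>i\<in>{1..d}. maximal_twin_set V (A i)) \<and>
           vec.dim (restrict_vec B ` V) \<le> 2 * h"
proof -
  obtain I b where card: "card I = vec.dim V" and bV: "\<And>i. i \<in> I \<Longrightarrow> b i \<in> V"
    and b: "\<And>i j. i \<in> I \<Longrightarrow> j \<in> I \<Longrightarrow> b i $ j = (if j = i then 1 else 0)"
    and expand: "\<And>v. v \<in> V \<Longrightarrow> v = (\<Sum>i\<in>I. v $ i *s b i)"
    using dual_basis_exists[OF assms(1)] by blast
  obtain g where g: "bij_betw g {1..d} I"
    using ex_bij_betw_nat_finite_1[of I] card assms(2) by auto
  define A where "A m = {k. twins V (g m) k}" for m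
  define B where "B = UNIV - (\<Union>m\<in>{1..d}. A m)"
  define K where "K = vec.span (\<Union>i\<in>I. (\<lambda>v. b i * v - (v $ i) *s b i) ` V)"
  have gI: "g m \<in> I" if "m \<in> {1..d}" for m
    using g that by (auto simp: bij_betw_def)
  have bI: "\<exists>v\<in>V. v $ i \<noteq> 0" if "i \<in> I" for i
    using bV[OF that] b[OF that that] by (intro bexI[of _ "b i"]) simp_all
  \<comment> \<open>Distinct members of \<open>I\<close> are not twins: \<open>b (g m)\<close> is 1
    at \<open>g m\<close> and 0 at \<open>g n\<close>.\<close>
  have disj: "disjoint_family_on A {1..d}"
    unfolding disjoint_family_on_def
  proof (intro ballI impI)
    fix m n assume mn: "m \<in> {1..d}" "n \<in> {1..d}" "m \<noteq> n"
    then have "g m \<noteq> g n"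
      using g unfolding bij_betw_def by (meson inj_onD)
    moreover have "g m \<in> I" "g n \<in> I" using gI mn by blast+
    ultimately have "b (g m) $ g m \<noteq> b (g m) $ g n" "b (g m) \<in> V"
      using b bV by auto
    then show "A m \<inter> A n = {}" by (auto simp: A_def twins_def)
  qed
  have maxi: "maximal_twin_set V (A m)" if "m \<in> {1..d}" for m
  proof -
    have A: "A m = {(i, j). twins V i j} `` {g m}" by (auto simp: A_def)
    have "g m \<in> active V"
      using bI[OF gI[OF that]] by (simp add: active_def)
    then show ?thesis
      unfolding maximal_twin_set_def A by (rule quotientI)
  qed
  \<comment> \<open>Some vector of \<open>V\<close> is nonzero at \<open>i\<close>, so
    \<open>k\<close> can fail to be a twin of \<open>i\<close> only by being separated from
    it.\<close>
  have nontwin: "\<exists>v\<in>V. v $ k \<noteq> v $ i" if i: "i \<in> I" and k: "k \<in> B" for i k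
  proof -
    obtain m where m: "m \<in> {1..d}" "i = g m"
      using bij_betw_imp_surj_on[OF g] i by blast
    then have "\<not> twins V i k" using k by (auto simp: B_def A_def)
    then show ?thesis using bI[OF i] unfolding twins_def by force
  qed
  \<comment> \<open>By the expansion in the \<open>b i\<close>, all of \<open>V\<close> vanishes
    wherever every \<open>b i\<close> does.\<close>
  have "restrict_vec B v = restrict_vec {k\<in>B. \<exists>i\<in>I. b i $ k \<noteq> 0} v" if "v \<in> V" for v
  proof -
    have "v $ k = 0" if "\<forall>i\<in>I. b i $ k = 0" for k
      by (subst expand[OF \<open>v \<in> V\<close>]) (simp add: sum_component that)
    then show ?thesis by (auto simp: restrict_vec_def vec_eq_iff)
  qed
  then have "restrict_vec B ` V = restrict_vec {k\<in>B. \<exists>i\<in>I. b i $ k \<noteq> 0} ` V"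
    by (intro image_cong refl)
  then have le: "vec.dim (restrict_vec B ` V) \<le> 2 * vec.dim K"
    using dim_restrict_supports_le[of I B V b] nontwin by (simp add: K_def)
  \<comment> \<open>At \<open>j\<close> different from \<open>i\<close> the factor
    \<open>b i $ j\<close> is 0; at \<open>j = i\<close> the generator is
    \<open>v $ i - v $ i\<close>.\<close>
  have K0: "x $ j = 0" if "x \<in> K" "j \<in> I" for x j
    using that(1) unfolding K_def
    by (induction rule: vec.span_induct_alt) (auto simp: b that(2) split: if_splits)
  \<comment> \<open>A vector of \<open>V\<close> that vanishes on \<open>I\<close> has only zero
    coefficients in its expansion.\<close>
  have "x = 0" if "x \<in> V" "x \<in> K" for x
    by (subst expand[OF that(1)]) (simp add: K0[OF that(2)])
  then have "vec.dim V + vec.dim K \<le> vec.dim (V \<union> K)"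
    by (intro dim_Un_ge_of_Int_trivial assms(1)) (auto simp: K_def vec.subspace_span)
  \<comment> \<open>\<open>V\<close> and \<open>K\<close> share a space of dimension
    \<open>d + h\<close> and meet trivially, which leaves at most \<open>h\<close> for
    \<open>K\<close>.\<close>
  also have "\<dots> \<le> vec.dim (vec.span (V \<union> coord_prods V))"
  proof (rule vec.dim_subset)
    have "(\<Union>i\<in>I. (\<lambda>v. b i * v - (v $ i) *s b i) ` V) \<subseteq> vec.span (V \<union> coord_prods V)"
    proof clarify
      fix i v assume "i \<in> I" "v \<in> V"
      then have "b i * v \<in> coord_prods V" "b i \<in> V"
        using bV unfolding coord_prods_def by blast+
      then show "b i * v - (v $ i) *s b i \<in> vec.span (V \<union> coord_prods V)"
        by (intro vec.span_diff vec.span_scale vec.span_base) auto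
    qed
    then have "K \<subseteq> vec.span (V \<union> coord_prods V)"
      unfolding K_def by (intro vec.span_minimal vec.subspace_span)
    then show "V \<union> K \<subseteq> vec.span (V \<union> coord_prods V)"
      by (auto intro: vec.span_base)
  qed
  finally have "vec.dim K \<le> h" using assms(2,3) by simp
  with le have "vec.dim (restrict_vec B ` V) \<le> 2 * h" by simp
  with disj maxi show ?thesis
    by (intro exI[of _ A] exI[of _ B]) (auto simp: B_def)
qed

end
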